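(* Let $(U,\mathcal{L})$ be an oriented matroid (OM) or a complex of uniform oriented matroids (CUOM), and let $\mathcal{C}\subseteq\{-1,+1\}^U$ be the concept class consisting of the topes of $\mathcal{L}$. If $\mathcal{C}$ has VC-dimension $d$, then $\mathcal{C}$ admits a labeled sample compression scheme of size $d$.
   Context: $U$ is a finite set. A system of sign vectors is a pair $(U,\mathcal{L})$ with $\mathcal{L}\subseteq\{-1,0,+1\}^U$; its elements are called covectors. For a sign vector $X$: the support is $\underline{X}=\{e\in U:X_e\ne 0\}$ and the zero set is $X^0=U\setminus\underline{X}$. For sign vectors $X,Y$: the separator is $S(X,Y)=\{e\in U: X_eY_e=-1\}$; the composition $X\circ Y$ is given by $(X\circ Y)_e=X_e$ if $X_e\neq 0$ and $(X\circ Y)_e=Y_e$ if $X_e=0$; and $\le$ is the product order on $\{-1,0,+1\}^U$ induced by $0\le -1$, $0\le +1$ (so $X\le Y$ iff $Y$ agrees with $X$ on $\underline{X}$). A complex of oriented matroids (COM) is a system of sign vectors $(U,\mathcal{L})$ satisfying: (SE) for all $X,Y\in\mathcal{L}$ and each $e\in S(X,Y)$ there is $Z\in\mathcal{L}$ with $Z_e=0$ and $Z_f=(X\circ Y)_f$ for all $f\in U\setminus S(X,Y)$; (FS) $X\circ(-Y)\in\mathcal{L}$ for all $X,Y\in\mathcal{L}$. An oriented matroid (OM) is a COM containing the zero vector (equivalently, a system closed under composition and under $X\mapsto -X$ and satisfying (SE)). Throughout, all systems are assumed simple: for each $e\in U$, $\{X_e:X\in\mathcal{L}\}=\{-1,0,+1\}$,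 and for each pair $e\neq f$ in $U$ there exist $X,Y\in\mathcal{L}$ with $\{X_eX_f,Y_eY_f\}=\{+1,-1\}$. The cocircuits of an OM are its minimal nonzero covectors. The rank of an OM is the length of the maximal chains of the poset $(\mathcal{L}\cup\{\hat 1\},\le)$ ($\hat 1$ an added maximum; length is number of elements minus one) minus one. A uniform oriented matroid (UOM) of rank $r$ on a set of size $m$ is an OM whose set of cocircuits consists of exactly two opposite signings of each subset of size $m-r+1$. The face of a covector $X\in\mathcal{L}$ is $F(X)=\{X\circ Y:Y\in\mathcal{L}\}$. Each face of a COM is an OM, after restricting its sign vectors to the coordinates in $X^0$. A facet of $\mathcal{L}$ is an inclusion-maximal face. A CUOM is a COM in which each facet is a UOM (on $X^0$). The topes of $\mathcal{L}$ are the covectors in $\{-1,+1\}^U$. Vectors in $\{-1,+1\}^U$ are identified with subsets of $U$ (the coordinates equal to $+1$). A set $X\subseteq U$ is shattered by a family $\mathcal{C}$ if every vector of $\{-1,+1\}^X$ is the restriction to $X$ of some member of $\mathcal{C}$; the VC-dimension of $\mathcal{C}$ is the largest size of a shattered set. For a concept class $\mathcal{C}\subseteq\{-1,+1\}^U$ let $\downarrow\mathcal{C}=\{X\in\{-1,0,+1\}^U:\exists C\in\mathcal{C},\ X\le C\}$ (the realizable samples). A labeled sample compression scheme of size $k$ for $\mathcal{C}$ is a pair of functions $\alpha:\{-1,0,+1\}^U\to\{-1,0,+1\}^U$ and $\beta:\{-1,0,+1\}^U\to\{-1,+1\}^U$ such that for every $X\in\downarrow\mathcal{C}$: $\alpha(X)\le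 X\le\beta(\alpha(X))$ and the support of $\alpha(X)$ has size at most $k$. *)

theory Defs
  imports Main
begin

text \<open>
  A sign vector on \<open>U\<close> is encoded as a function with values in \<open>{-1, 0, 1}\<close> on \<open>U\<close> and
  value \<open>0\<close> outside \<open>U\<close>. Hence sign vectors on \<open>U\<close> are equal iff they agree on \<open>U\<close>, and
  support, separator, composition and order need no reference to \<open>U\<close>.
\<close>

type_synonym 'a signvec = "'a \<Rightarrow> int"

definition sign_vectors :: "'a set \<Rightarrow> 'a signvec set" where
  "sign_vectors U = {X. (\<forall>e\<in>U. X e \<in> {-1, 0, 1}) \<and> (\<forall>e. e \<notin> U \<longrightarrow> X e = 0)}"

definition full_sign_vectors :: "'a set \<Rightarrow> 'a signvec set" where
  "full_sign_vectors U = {X. (\<forall>e\<in>U. X e \<in> {-1, 1}) \<and> (\<forall>e. e \<notin> U \<longrightarrow> X e = 0)}"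

definition zero_vec :: "'a signvec" where
  "zero_vec = (\<lambda>e. 0)"

definition neg_vec :: "'a signvec \<Rightarrow> 'a signvec" where
  "neg_vec X = (\<lambda>e. - X e)"

definition restrict_vec :: "'a set \<Rightarrow> 'a signvec \<Rightarrow> 'a signvec" where
  "restrict_vec A X = (\<lambda>e. if e \<in> A then X e else 0)"

definition supp :: "'a signvec \<Rightarrow> 'a set" where
  "supp X = {e. X e \<noteq> 0}"

definition zero_set :: "'a set \<Rightarrow> 'a signvec \<Rightarrow> 'a set" where
  "zero_set U X = U - supp X"

definition separator :: "'a signvec \<Rightarrow> 'a signvec \<Rightarrow> 'a set" where
  "separator X Y = {e. X e * Y e = -1}"

definition compose :: "'a signvec \<Rightarrow> 'a signvec \<Rightarrow> 'a signvec" where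
  "compose X Y = (\<lambda>e. if X e \<noteq> 0 then X e else Y e)"

definition sv_le :: "'a signvec \<Rightarrow> 'a signvec \<Rightarrow> bool" where
  "sv_le X Y \<longleftrightarrow> (\<forall>e. X e = 0 \<or> X e = Y e)"

definition strong_elimination :: "'a set \<Rightarrow> 'a signvec set \<Rightarrow> bool" where
  "strong_elimination U L \<longleftrightarrow>
     (\<forall>X\<in>L. \<forall>Y\<in>L. \<forall>e\<in>separator X Y.
        \<exists>Z\<in>L. Z e = 0 \<and> (\<forall>f\<in>U - separator X Y. Z f = compose X Y f))"

definition face_symmetry :: "'a signvec set \<Rightarrow> bool" where
  "face_symmetry L \<longleftrightarrow> (\<forall>X\<in>L. \<forall>Y\<in>L. compose X (neg_vec Y) \<in> L)"

definition is_COM :: "'a set \<Rightarrow> 'a signvec set \<Rightarrow> bool" where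
  "is_COM U L \<longleftrightarrow> L \<subseteq> sign_vectors U \<and> strong_elimination U L \<and> face_symmetry L"

definition is_OM :: "'a set \<Rightarrow> 'a signvec set \<Rightarrow> bool" where
  "is_OM U L \<longleftrightarrow> is_COM U L \<and> zero_vec \<in> L"

definition simple_system :: "'a set \<Rightarrow> 'a signvec set \<Rightarrow> bool" where
  "simple_system U L \<longleftrightarrow>
     (\<forall>e\<in>U. (\<lambda>X. X e) ` L = {-1, 0, 1}) \<and>
     (\<forall>e\<in>U. \<forall>f\<in>U. e \<noteq> f \<longrightarrow>
        (\<exists>X\<in>L. \<exists>Y\<in>L. {X e * X f, Y e * Y f} = {1, -1}))"

definition cocircuits :: "'a signvec set \<Rightarrow> 'a signvec set" where
  "cocircuits L =
     {X\<in>L. X \<noteq> zero_vec \<and> (\<forall>Y\<in>L. Y \<noteq> zero_vec \<and> sv_le Y X \<longrightarrow> Y = X)}"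

text \<open>The order on \<open>L\<close> with an added maximum, which is represented by \<open>None\<close>.\<close>

definition le_top :: "'a signvec option \<Rightarrow> 'a signvec option \<Rightarrow> bool" where
  "le_top x y \<longleftrightarrow> y = None \<or> (\<exists>X Y. x = Some X \<and> y = Some Y \<and> sv_le X Y)"

text \<open>
  The length of a chain is its number of elements minus one, and the rank is the length of the
  maximal chains minus one; so rank \<open>r\<close> means that the maximal chains have \<open>r + 2\<close> elements.
\<close>

definition has_rank :: "'a signvec set \<Rightarrow> nat \<Rightarrow> bool" where
  "has_rank L r \<longleftrightarrow>
     (\<forall>c. pred_on.maxchain (insert None (Some ` L)) le_top c \<longrightarrow> card c = r + 2)"

definition is_UOM_of_rank :: "'a set \<Rightarrow> 'a signvec set \<Rightarrow> nat \<Rightarrow> bool" where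
  "is_UOM_of_rank U L r \<longleftrightarrow>
     is_OM U L \<and> has_rank L r \<and>
     (\<forall>X\<in>cocircuits L. card (supp X) = card U - r + 1) \<and>
     (\<forall>A\<subseteq>U. card A = card U - r + 1 \<longrightarrow>
        (\<exists>X. {Y\<in>cocircuits L. supp Y = A} = {X, neg_vec X}))"

definition face :: "'a signvec set \<Rightarrow> 'a signvec \<Rightarrow> 'a signvec set" where
  "face L X = compose X ` L"

definition is_CUOM :: "'a set \<Rightarrow> 'a signvec set \<Rightarrow> bool" where
  "is_CUOM U L \<longleftrightarrow>
     is_COM U L \<and>
     (\<forall>X\<in>L. (\<forall>Y\<in>L. face L X \<subseteq> face L Y \<longrightarrow> face L Y = face L X) \<longrightarrow>
        (\<exists>r. is_UOM_of_rank (zero_set U X) (restrict_vec (zero_set U X) ` face L X) r))"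

definition topes :: "'a set \<Rightarrow> 'a signvec set \<Rightarrow> 'a signvec set" where
  "topes U L = L \<inter> full_sign_vectors U"

definition shattered :: "'a signvec set \<Rightarrow> 'a set \<Rightarrow> bool" where
  "shattered C A \<longleftrightarrow> full_sign_vectors A \<subseteq> restrict_vec A ` C"

definition VC_dim :: "'a set \<Rightarrow> 'a signvec set \<Rightarrow> nat" where
  "VC_dim U C = Max {card A | A. A \<subseteq> U \<and> shattered C A}"

definition realizable_samples :: "'a set \<Rightarrow> 'a signvec set \<Rightarrow> 'a signvec set" where
  "realizable_samples U C = {X\<in>sign_vectors U. \<exists>Y\<in>C. sv_le X Y}"

definition labeled_compression_scheme ::
  "'a set \<Rightarrow> 'a signvec set \<Rightarrow> nat \<Rightarrow>
   ('a signvec \<Rightarrow> 'a signvec) \<Rightarrow> ('a signvec \<Rightarrow> 'a signvec) \<Rightarrow> bool" where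
  "labeled_compression_scheme U C k \<alpha> \<beta> \<longleftrightarrow>
     \<alpha> ` sign_vectors U \<subseteq> sign_vectors U \<and>
     \<beta> ` sign_vectors U \<subseteq> full_sign_vectors U \<and>
     (\<forall>X\<in>realizable_samples U C.
        sv_le (\<alpha> X) X \<and> sv_le X (\<beta> (\<alpha> X)) \<and> card (supp (\<alpha> X)) \<le> k)"

end

theory Submission
  imports Defs
begin

text \<open>
  The argument works for every COM. Let \<open>M\<close> be the deletion of \<open>L\<close> to the support \<open>D\<close> of a sample,
  so that the sample \<open>T\<close> is a tope of \<open>M\<close>, and fix a linear order on \<open>U\<close>. Start with a minimal
  covector \<open>P \<le> T\<close> of \<open>M\<close>; as long as \<open>P\<close> has zeros in \<open>D\<close>, let \<open>a\<close> be the first of them and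
  replace \<open>P\<close> by a minimal covector between \<open>P\<close> and \<open>T\<close> that is nonzero at \<open>a\<close>. The sample is
  compressed to its restriction to the set \<open>A\<close> of the elements \<open>a\<close> used. Strong elimination shows
  that \<open>P\<close> is determined on \<open>D\<close> by vanishing on \<open>A\<close>, and each later covector of the flag by its
  predecessor, its sign at \<open>a\<close>, and vanishing on the later elements of \<open>A\<close>. As the elements of
  \<open>A\<close> are used in increasing order, the flag can be rebuilt inside \<open>L\<close> without knowing \<open>D\<close>. Face
  symmetry shows that \<open>A\<close> is shattered by the topes.
\<close>

section \<open>Complexes of oriented matroids\<close>

lemma sign_vectors_values:
  assumes "X \<in> sign_vectors U"
  shows "X e = -1 \<or> X e = 0 \<or> X e = 1"
  using assms by (cases "e \<in> U") (auto simp: sign_vectors_def)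

lemma supp_sign_vectors: "X \<in> sign_vectors U \<Longrightarrow> supp X \<subseteq> U"
  by (auto simp: sign_vectors_def supp_def)

lemma COM_signs: "is_COM U L \<Longrightarrow> X \<in> L \<Longrightarrow> X \<in> sign_vectors U"
  by (auto simp: is_COM_def)

lemma COM_elimination:
  assumes "is_COM U L" "X \<in> L" "Y \<in> L" "X e * Y e = -1"
  obtains Z where "Z \<in> L" "Z e = 0" "\<And>f. X f * Y f \<noteq> -1 \<Longrightarrow> Z f = compose X Y f"
proof -
  obtain Z where Z: "Z \<in> L" "Z e = 0" "\<forall>f\<in>U - separator X Y. Z f = compose X Y f"
    using assms unfolding is_COM_def strong_elimination_def separator_def by blast
  have "Z f = compose X Y f" if "X f * Y f \<noteq> -1" for f
  proof (cases "f \<in> U")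
    case True
    with that Z(3) show ?thesis by (simp add: separator_def)
  next
    case False
    have "X f = 0" "Y f = 0" "Z f = 0"
      using False COM_signs[OF assms(1)] assms(2,3) Z(1) by (auto simp: sign_vectors_def)
    then show ?thesis by (simp add: compose_def)
  qed
  with Z show thesis by (intro that)
qed

lemma COM_face_symmetry:
  "is_COM U L \<Longrightarrow> X \<in> L \<Longrightarrow> Y \<in> L \<Longrightarrow> compose X (neg_vec Y) \<in> L"
  by (auto simp: is_COM_def face_symmetry_def)

text \<open>Face symmetry composes only with a negated vector; applying it twice cancels the sign on
  the zeros of \<open>X\<close>.\<close>

lemma COM_compose:
  assumes "is_COM U L" "X \<in> L" "Y \<in> L"
  shows "compose X Y \<in> L"
proof -
  have "compose X Y = compose X (neg_vec (compose X (neg_vec Y)))"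
    by (auto simp: compose_def neg_vec_def)
  with assms show ?thesis by (metis COM_face_symmetry)
qed

text \<open>Makes a realizable sample with support \<open>D\<close> a tope of a COM on
  \<open>D\<close>. The axioms are checked on lifts to \<open>L\<close>, since restriction commutes
  with composition and negation.\<close>

lemma COM_deletion:
  assumes L: "is_COM U L" and D: "D \<subseteq> U"
  shows "is_COM D (restrict_vec D ` L)"
  unfolding is_COM_def
proof (intro conjI)
  show "restrict_vec D ` L \<subseteq> sign_vectors D"
    using COM_signs[OF L] D by (fastforce simp: sign_vectors_def restrict_vec_def)
  show "strong_elimination D (restrict_vec D ` L)"
    unfolding strong_elimination_def
  proof (intro ballI)
    fix X' Y' e
    assume "X' \<in> restrict_vec D ` L" "Y' \<in> restrict_vec D ` L" and e: "e \<in> separator X' Y'"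
    then obtain X Y where X: "X \<in> L" "X' = restrict_vec D X" and Y: "Y \<in> L" "Y' = restrict_vec D Y"
      by blast
    have "X e * Y e = -1"
      using e X Y by (auto simp: separator_def restrict_vec_def split: if_splits)
    then obtain Z where Z: "Z \<in> L" "Z e = 0" "\<And>f. X f * Y f \<noteq> -1 \<Longrightarrow> Z f = compose X Y f"
      using COM_elimination[OF L X(1) Y(1)] by metis
    have "restrict_vec D Z f = compose X' Y' f" if "f \<in> D - separator X' Y'" for f
    proof -
      have "f \<in> D" "X' f = X f" "Y' f = Y f"
        using that X(2) Y(2) by (auto simp: restrict_vec_def)
      then show ?thesis using that Z(3)[of f] by (simp add: restrict_vec_def separator_def compose_def)
    qed
    with Z show "\<exists>Z\<in>restrict_vec D ` L. Z e = 0 \<and> (\<forall>f\<in>D - separator X' Y'. Z f = compose X' Y' f)"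
      by (intro bexI[of _ "restrict_vec D Z"]) (auto simp: restrict_vec_def)
  qed
  show "face_symmetry (restrict_vec D ` L)"
    unfolding face_symmetry_def
  proof (intro ballI)
    fix X' Y'
    assume "X' \<in> restrict_vec D ` L" "Y' \<in> restrict_vec D ` L"
    then obtain X Y where X: "X \<in> L" "X' = restrict_vec D X" and Y: "Y \<in> L" "Y' = restrict_vec D Y"
      by blast
    have "compose X' (neg_vec Y') = restrict_vec D (compose X (neg_vec Y))"
      using X Y by (auto simp: compose_def neg_vec_def restrict_vec_def)
    with COM_face_symmetry[OF L X(1) Y(1)] show "compose X' (neg_vec Y') \<in> restrict_vec D ` L"
      by blast
  qed
qed

section \<open>Flags of covectors\<close>

text \<open>\<open>B = {}\<close> gives the minimal covectors of \<open>M\<close>. For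
  \<open>B = insert a (supp P)\<close> and \<open>sv_le P Y\<close>, the competitors below
  \<open>Y\<close> are those that stay above \<open>P\<close> and keep the sign of \<open>Y\<close>
  at \<open>a\<close>.\<close>

definition minimal_on :: "'a signvec set \<Rightarrow> 'a set \<Rightarrow> 'a signvec \<Rightarrow> bool" where
  "minimal_on M B Y \<longleftrightarrow>
     Y \<in> M \<and> (\<forall>Z\<in>M. sv_le Z Y \<and> (\<forall>b\<in>B. Z b = Y b) \<longrightarrow> Z = Y)"

lemma minimal_on_exists:
  assumes "finite (supp T)" "T \<in> M"
  obtains Y where "minimal_on M B Y" "sv_le Y T" "\<forall>b\<in>B. Y b = T b"
proof -
  let ?Q = "\<lambda>Y. Y \<in> M \<and> sv_le Y T \<and> (\<forall>b\<in>B. Y b = T b)"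
  have "?Q T" using assms by (simp add: sv_le_def)
  then obtain Y where Y: "?Q Y" and least: "\<And>Z. ?Q Z \<Longrightarrow> card (supp Y) \<le> card (supp Z)"
    using arg_min_natI[of ?Q T "\<lambda>Y. card (supp Y)"] arg_min_nat_le[of ?Q _ "\<lambda>Y. card (supp Y)"]
    by blast
  have "Z = Y" if Z: "Z \<in> M" "sv_le Z Y" "\<forall>b\<in>B. Z b = Y b" for Z
  proof -
    have "?Q Z" using Z Y unfolding sv_le_def by metis
    then have "card (supp Y) \<le> card (supp Z)" by (rule least)
    moreover have "finite (supp Y)"
      using Y finite_subset[OF _ assms(1), of "supp Y"] by (fastforce simp: sv_le_def supp_def)
    moreover have "supp Z \<subseteq> supp Y" using Z(2) by (force simp: sv_le_def supp_def)
    ultimately have "supp Z = supp Y" by (simp add: card_seteq)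
    then show "Z = Y" using Z(2) by (fastforce simp: sv_le_def supp_def)
  qed
  with Y show thesis by (intro that) (auto simp: minimal_on_def)
qed

text \<open>Allows a minimal covector to be recognised by its support and its signs on
  \<open>B\<close> alone. Eliminating between \<open>Z\<close> and \<open>Y\<close> preserves the
  hypotheses and shrinks the separator, so by induction the result is \<open>Y\<close>; yet it
  vanishes at an element where \<open>Y\<close> does not.\<close>

lemma minimal_on_unique:
  assumes M: "is_COM D M" and fin: "finite D" and Y: "minimal_on M B Y"
    and "Z \<in> M" "\<forall>b\<in>B. Z b = Y b" "supp Z \<subseteq> supp Y"
  shows "Z = Y"
  using assms(4-)
proof (induction "card (separator Z Y)" arbitrary: Z rule: less_induct)
  case less
  have YM: "Y \<in> M" using Y by (simp add: minimal_on_def)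
  note signs = sign_vectors_values[OF COM_signs[OF M YM]]
    sign_vectors_values[OF COM_signs[OF M less.prems(1)]]
  show ?case
  proof (cases "separator Z Y = {}")
    case True
    have "sv_le Z Y"
      unfolding sv_le_def
    proof
      fix e
      have "Z e * Y e \<noteq> -1" "Z e \<noteq> 0 \<Longrightarrow> Y e \<noteq> 0"
        using True less.prems(3) by (auto simp: separator_def supp_def)
      then show "Z e = 0 \<or> Z e = Y e" using signs[of e] by auto
    qed
    with Y less.prems show ?thesis by (simp add: minimal_on_def)
  next
    case False
    then obtain e where e: "Z e * Y e = -1" by (auto simp: separator_def)
    then obtain V where V: "V \<in> M" "V e = 0" "\<And>f. Z f * Y f \<noteq> -1 \<Longrightarrow> V f = compose Z Y f"
      using COM_elimination[OF M less.prems(1) YM] by metis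
    \<comment> \<open>Off the separator of \<open>Z\<close> and \<open>Y\<close>, \<open>V\<close>
      takes the value of \<open>Z\<close> or, where that is zero, of \<open>Y\<close>, so it never
      opposes \<open>Y\<close> there.\<close>
    have "separator V Y \<subseteq> separator Z Y - {e}"
    proof
      fix f assume f: "f \<in> separator V Y"
      then have "Z f * Y f = -1"
        using V(3)[of f] signs[of f] by (auto simp: separator_def compose_def split: if_splits)
      with f V(2) show "f \<in> separator Z Y - {e}" by (auto simp: separator_def)
    qed
    moreover have "finite (separator Z Y)"
    proof (rule finite_subset[OF _ fin])
      show "separator Z Y \<subseteq> D"
        using supp_sign_vectors[OF COM_signs[OF M YM]] by (force simp: separator_def supp_def)
    qed
    moreover have "e \<in> separator Z Y" using e by (simp add: separator_def)
    ultimately have "card (separator V Y) < card (separator Z Y)"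
      by (intro psubset_card_mono) auto
    moreover have "\<forall>b\<in>B. V b = Y b"
    proof
      fix b assume "b \<in> B"
      with less.prems(2) have "Z b = Y b" by simp
      moreover from this have "Z b * Y b \<noteq> -1" using signs[of b] by auto
      ultimately show "V b = Y b" using V(3) by (simp add: compose_def)
    qed
    moreover have "supp V \<subseteq> supp Y"
    proof
      fix f assume "f \<in> supp V"
      then show "f \<in> supp Y"
        using V(3)[of f] less.prems(3)
        by (cases "Y f = 0") (auto simp: supp_def compose_def split: if_splits)
    qed
    ultimately have "V = Y" using less.hyps V(1) by blast
    with V(2) e show ?thesis by auto
  qed
qed

text \<open>Only the elements \<open>a\<close> are recorded; the intermediate covectors stay
  existential, as the decoder has to recover them from these elements and their signs.\<close>

inductive flag :: "'a signvec set \<Rightarrow> 'a signvec \<Rightarrow> 'a signvec \<Rightarrow> 'a list \<Rightarrow> bool"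
  for M T where
  Nil: "T \<in> M \<Longrightarrow> flag M T T []"
| Cons: "P \<in> M \<Longrightarrow> P a = 0 \<Longrightarrow> Y a \<noteq> 0 \<Longrightarrow> sv_le P Y \<Longrightarrow> minimal_on M (insert a (supp P)) Y \<Longrightarrow>
    flag M T Y as \<Longrightarrow> flag M T P (a # as)"

lemma flag_le: "flag M T P as \<Longrightarrow> sv_le P T"
proof (induction rule: flag.induct)
  case (Cons P a Y as)
  then show ?case unfolding sv_le_def by metis
qed (simp add: sv_le_def)

lemma flag_elements:
  "flag M T P as \<Longrightarrow> b \<in> set as \<Longrightarrow> P b = 0 \<and> T b \<noteq> 0"
proof (induction rule: flag.induct)
  case (Cons P a Y as)
  show ?case
  proof (cases "b = a")
    case True
    then show ?thesis using Cons.hyps flag_le[OF Cons.hyps(6)] unfolding sv_le_def by metis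
  next
    case False
    then show ?thesis using Cons unfolding sv_le_def by (metis set_ConsD)
  qed
qed simp

text \<open>Scans \<open>xs\<close> greedily, taking a step at each zero of the current covector in
  the support of \<open>T\<close>. The filter equation says that the set of \<open>as\<close> and
  the order of \<open>xs\<close> determine the list.\<close>

lemma flag_exists:
  assumes "finite (supp T)" "T \<in> M" "P \<in> M" "sv_le P T" "supp T - supp P \<subseteq> set xs" "distinct xs"
  shows "\<exists>as. flag M T P as \<and> filter (\<lambda>x. x \<in> set as) xs = as"
  using assms(3-)
proof (induction xs arbitrary: P)
  case Nil
  have "P = T"
  proof
    fix e
    show "P e = T e" using Nil by (cases "P e = 0") (auto simp: sv_le_def supp_def)
  qed
  with assms(2) flag.Nil show ?case by fastforce
next
  case (Cons x xs)
  show ?case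
  proof (cases "P x = 0 \<and> T x \<noteq> 0")
    case True
    obtain Y where Y: "minimal_on M (insert x (supp P)) Y" "sv_le Y T"
        "\<forall>b\<in>insert x (supp P). Y b = T b"
      using minimal_on_exists[OF assms(1,2)] by blast
    have le: "sv_le P Y"
      unfolding sv_le_def
    proof
      fix e
      have "P e = 0 \<or> P e = T e" using Cons.prems(2) by (simp add: sv_le_def)
      moreover have "P e \<noteq> 0 \<Longrightarrow> Y e = T e" using Y(3) by (simp add: supp_def)
      ultimately show "P e = 0 \<or> P e = Y e" by metis
    qed
    have "supp T - supp Y \<subseteq> set xs"
      using Cons.prems(3) Y(3) True by (fastforce simp: supp_def)
    then obtain as where as: "flag M T Y as" "filter (\<lambda>y. y \<in> set as) xs = as"
      using Cons.IH[of Y] Y Cons.prems(4) by (auto simp: minimal_on_def)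
    have "flag M T P (x # as)"
      using True Y le as(1) Cons.prems(1) by (intro flag.Cons[of P _ _ Y]) auto
    moreover have "filter (\<lambda>y. y \<in> set (x # as)) (x # xs) = x # as"
    proof -
      have "filter (\<lambda>y. y \<in> set (x # as)) xs = filter (\<lambda>y. y \<in> set as) xs"
        using Cons.prems(4) by (intro filter_cong) auto
      with as(2) show ?thesis by simp
    qed
    ultimately show ?thesis by blast
  next
    case False
    have "supp T - supp P \<subseteq> set xs"
      using False Cons.prems(3) by (auto simp: supp_def)
    then obtain as where as: "flag M T P as" "filter (\<lambda>y. y \<in> set as) xs = as"
      using Cons.IH[of P] Cons.prems by auto
    have "x \<notin> set as" using flag_elements[OF as(1)] False by blast
    with as show ?thesis by auto
  qed
qed

text \<open>If \<open>V\<close> were nonzero at some \<open>f\<close> outside \<open>supp P\<close>,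
  a sign choice for \<open>V\<close> would make \<open>P\<close>, then \<open>V\<close>, then
  \<open>Y\<close> compose to a rival of \<open>Y\<close> with the opposite sign at
  \<open>f\<close>, against uniqueness.\<close>

lemma flag_spanning:
  assumes M: "is_COM D M" and fin: "finite D" and T: "supp T = D"
    and "flag M T P as" "V \<in> M" "\<forall>b\<in>set as. V b = 0"
  shows "supp V \<subseteq> supp P"
  using assms(4-)
proof (induction rule: flag.induct)
  case Nil
  then show ?case using T supp_sign_vectors[OF COM_signs[OF M]] by blast
next
  case (Cons P a Y as)
  have VY: "supp V \<subseteq> supp Y" using Cons by simp
  have YM: "Y \<in> M" using Cons.hyps by (simp add: minimal_on_def)
  show ?case
  proof
    fix f assume f: "f \<in> supp V"
    have "\<exists>V'\<in>{V, neg_vec V}. V' f = - Y f"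
      using f VY sign_vectors_values[OF COM_signs[OF M YM], of f]
        sign_vectors_values[OF COM_signs[OF M Cons.prems(1)], of f]
      by (auto simp: supp_def neg_vec_def)
    then obtain V' where V': "V' \<in> {V, neg_vec V}" "V' f = - Y f" by blast
    let ?Z = "compose (compose P V') Y"
    \<comment> \<open>\<open>neg_vec V\<close> itself may lie outside \<open>M\<close>; face
      symmetry applies once it is composed after \<open>P\<close>.\<close>
    have "compose P V' \<in> M"
      using V'(1) COM_compose[OF M] COM_face_symmetry[OF M] Cons by blast
    then have "?Z \<in> M" using COM_compose[OF M] YM by blast
    moreover have "\<forall>b\<in>insert a (supp P). ?Z b = Y b"
      using Cons V'(1) by (auto simp: compose_def supp_def sv_le_def neg_vec_def)
    moreover have "supp ?Z \<subseteq> supp Y"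
    proof
      fix g assume "g \<in> supp ?Z"
      then have "P g \<noteq> 0 \<or> V g \<noteq> 0 \<or> Y g \<noteq> 0"
        using V'(1) by (auto simp: compose_def supp_def neg_vec_def split: if_splits)
      then show "g \<in> supp Y" using VY Cons.hyps(4) unfolding supp_def sv_le_def by force
    qed
    ultimately have "?Z = Y"
      using minimal_on_unique[OF M fin Cons.hyps(5)] by blast
    then have "?Z f = Y f" by simp
    moreover have "Y f \<noteq> 0" using f VY by (auto simp: supp_def)
    ultimately show "f \<in> supp P"
      using V'(2) by (auto simp: compose_def supp_def split: if_splits)
  qed
qed

text \<open>A pattern with the sign of \<open>Y\<close> at \<open>a\<close> is realized above
  \<open>Y\<close>. Otherwise its negative is realized there and reflected through \<open>P\<close>,
  which vanishes on the whole list.\<close>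

lemma flag_signs:
  assumes M: "is_COM D M"
    and "flag M T P as" "\<forall>b\<in>set as. s b \<in> {-1, 1}"
  shows "\<exists>V\<in>M. sv_le P V \<and> (\<forall>b\<in>set as. V b = s b)"
  using assms(2-)
proof (induction arbitrary: s rule: flag.induct)
  case Nil
  then show ?case by (auto simp: sv_le_def)
next
  case (Cons P a Y as)
  have YM: "Y \<in> M" using Cons.hyps by (simp add: minimal_on_def)
  have sa: "s a = Y a \<or> s a = - Y a"
    using sign_vectors_values[OF COM_signs[OF M YM], of a] Cons.prems Cons.hyps(3) by auto
  show ?case
  proof (cases "s a = Y a")
    case True
    obtain V where V: "V \<in> M" "sv_le Y V" "\<forall>b\<in>set as. V b = s b"
      using Cons.IH[of s] Cons.prems by auto
    have "sv_le P V" using Cons.hyps(4) V(2) unfolding sv_le_def by metis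
    moreover have "V a = s a" using V(2) True Cons.hyps(3) unfolding sv_le_def by metis
    ultimately show ?thesis using V by (intro bexI[of _ V]) auto
  next
    case False
    obtain V where V: "V \<in> M" "sv_le Y V" "\<forall>b\<in>set as. V b = - s b"
      using Cons.IH[of "\<lambda>b. - s b"] Cons.prems by force
    have "V a = - s a" using V(2) sa False Cons.hyps(3) unfolding sv_le_def by force
    moreover have "P b = 0" if "b \<in> set as" for b
      using flag_elements[OF flag.Cons[OF Cons.hyps(1-6)], of b] that by simp
    ultimately have "\<forall>b\<in>set (a # as). compose P (neg_vec V) b = s b"
      using V(3) Cons.hyps(2) by (auto simp: compose_def neg_vec_def)
    moreover have "compose P (neg_vec V) \<in> M" using COM_face_symmetry[OF M] Cons.hyps(1) V(1) by blast
    moreover have "sv_le P (compose P (neg_vec V))" by (auto simp: sv_le_def compose_def)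
    ultimately show ?thesis by blast
  qed
qed

section \<open>Compression\<close>

text \<open>Rebuilds a flag from above \<open>W\<close> inside \<open>L\<close>, given the signs of its tope at the listed elements.\<close>

fun rebuild :: "'a signvec set \<Rightarrow> 'a signvec \<Rightarrow> 'a signvec \<Rightarrow> 'a list \<Rightarrow> 'a signvec" where
  "rebuild L S W [] = W"
| "rebuild L S W (a # as) =
     rebuild L S (compose W (SOME V. V \<in> L \<and> V a = S a \<and> (\<forall>b\<in>set as. V b = 0))) as"

text \<open>The invariant is that \<open>W\<close> restricts on \<open>D\<close> to the current flag
  member. Spanning bounds the support of the next composition, and uniqueness identifies it on
  \<open>D\<close>, whichever \<open>V\<close> was chosen.\<close>

lemma rebuild_flag:
  assumes L: "is_COM U L" and D: "D \<subseteq> U" and fin: "finite D" and T: "supp T = D"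
    and "flag (restrict_vec D ` L) T P as" "W \<in> L" "restrict_vec D W = P" "\<forall>b\<in>set as. S b = T b"
  shows "restrict_vec D (rebuild L S W as) = T"
  using assms(5-)
proof (induction arbitrary: W rule: flag.induct)
  case (Cons P a Y as)
  note M = COM_deletion[OF L D]
  have aD: "b \<in> D" if "b \<in> set (a # as)" for b
    using flag_elements[OF flag.Cons[OF Cons.hyps(1-6)] that] T by (auto simp: supp_def)
  define V where "V = (SOME V. V \<in> L \<and> V a = S a \<and> (\<forall>b\<in>set as. V b = 0))"
  have Ya: "Y a = S a"
    using flag_le[OF Cons.hyps(6)] Cons.hyps(3) Cons.prems(3) by (auto simp: sv_le_def)
  \<comment> \<open>Any lift to \<open>L\<close> of the next flag member \<open>Y\<close> is a
    witness.\<close>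
  have "\<exists>V. V \<in> L \<and> V a = S a \<and> (\<forall>b\<in>set as. V b = 0)"
  proof -
    obtain Y' where Y': "Y' \<in> L" "Y = restrict_vec D Y'"
      using Cons.hyps(5) by (auto simp: minimal_on_def)
    have "Y' b = Y b" if "b \<in> set (a # as)" for b
      using aD[OF that] Y'(2) by (simp add: restrict_vec_def)
    then show ?thesis
      using Y'(1) Ya flag_elements[OF Cons.hyps(6)] by (intro exI[of _ Y']) auto
  qed
  from someI_ex[OF this] have V: "V \<in> L" "V a = S a" "\<forall>b\<in>set as. V b = 0"
    unfolding V_def by blast+
  have W: "W b = P b" if "b \<in> D" for b
    using Cons.prems(2) that by (auto simp: restrict_vec_def)
  have P: "P b = 0" if "b \<in> set (a # as)" for b
    using flag_elements[OF flag.Cons[OF Cons.hyps(1-6)] that] by simp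
  let ?Z = "restrict_vec D (compose W V)"
  have WV: "compose W V \<in> L" using COM_compose[OF L Cons.prems(1) V(1)] .
  have "?Z b = 0" if "b \<in> set as" for b
    using W[of b] aD[of b] P[of b] V(3) that by (auto simp: restrict_vec_def compose_def)
  then have "supp ?Z \<subseteq> supp Y"
    using flag_spanning[OF M fin T Cons.hyps(6)] WV by blast
  moreover have "?Z b = Y b" if "b \<in> insert a (supp P)" for b
  proof (cases "b = a")
    case True
    then show ?thesis using W[of a] aD[of a] P[of a] V(2) Ya by (auto simp: restrict_vec_def compose_def)
  next
    case False
    then have Pb: "P b \<noteq> 0" using that by (simp add: supp_def)
    then have "b \<in> D" using Cons.prems(2) by (auto simp: restrict_vec_def split: if_splits)
    with Pb W[of b] Cons.hyps(4) show ?thesis by (auto simp: restrict_vec_def compose_def sv_le_def)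
  qed
  ultimately have "?Z = Y"
    using minimal_on_unique[OF M fin Cons.hyps(5)] WV by blast
  then show ?case using Cons.IH[OF WV] Cons.prems(3) by (simp add: V_def)
qed simp

text \<open>Composing with the tope \<open>C\<close> fills the zeros of a covector realizing
  \<open>s\<close> and keeps its signs on \<open>as\<close>.\<close>

lemma flag_shattered:
  assumes L: "is_COM U L" and D: "D \<subseteq> U" and T: "supp T = D"
    and F: "flag (restrict_vec D ` L) T P as" and C: "C \<in> topes U L"
  shows "shattered (topes U L) (set as)"
  unfolding shattered_def
proof
  fix s assume s: "s \<in> full_sign_vectors (set as)"
  then obtain V where V: "V \<in> L" "\<forall>b\<in>set as. restrict_vec D V b = s b"
    using flag_signs[OF COM_deletion[OF L D] F, of s] by (auto simp: full_sign_vectors_def)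
  have "compose V C \<in> L" using COM_compose[OF L V(1)] C by (simp add: topes_def)
  moreover have "compose V C e \<in> {-1, 1}" if "e \<in> U" for e
    using C that sign_vectors_values[OF COM_signs[OF L V(1)], of e]
    by (auto simp: topes_def full_sign_vectors_def compose_def)
  ultimately have "compose V C \<in> topes U L"
    using COM_signs[OF L] by (auto simp: topes_def full_sign_vectors_def sign_vectors_def)
  moreover have "s = restrict_vec (set as) (compose V C)"
  proof
    fix e
    have "e \<in> D" if "e \<in> set as" using flag_elements[OF F that] T by (auto simp: supp_def)
    moreover have "s e \<noteq> 0" if "e \<in> set as" using s that by (auto simp: full_sign_vectors_def)
    ultimately show "s e = restrict_vec (set as) (compose V C) e"
      using V(2) s by (auto simp: restrict_vec_def compose_def full_sign_vectors_def)
  qed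
  ultimately show "s \<in> restrict_vec (set as) ` topes U L" by blast
qed

lemma card_shattered_le_VC_dim:
  assumes "finite U" "A \<subseteq> U" "shattered C A"
  shows "card A \<le> VC_dim U C"
  unfolding VC_dim_def
proof (rule Max_ge)
  have "{card A | A. A \<subseteq> U \<and> shattered C A} \<subseteq> card ` Pow U" by auto
  then show "finite {card A | A. A \<subseteq> U \<and> shattered C A}"
    using assms(1) finite_subset by fastforce
qed (use assms in auto)

theorem COM_compression:
  assumes fin: "finite U" and L: "is_COM U L"
  shows "\<exists>\<alpha> \<beta>. labeled_compression_scheme U (topes U L) (VC_dim U (topes U L)) \<alpha> \<beta>"
proof -
  obtain xs where xs: "set xs = U" "distinct xs" using finite_distinct_list[OF fin] by blast
  \<comment> \<open>The fixed order \<open>xs\<close> lets the decoder read off the order of the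
    flag steps from the support of \<open>S\<close>.\<close>
  define as_of where "as_of S = filter (\<lambda>x. S x \<noteq> 0) xs" for S :: "'a signvec"
  define w where
    "w S = rebuild L S (SOME W. W \<in> L \<and> (\<forall>b\<in>set (as_of S). W b = 0)) (as_of S)" for S
  \<comment> \<open>The default -1 replaces zeros of \<open>w S\<close>; none occur on the support
    of the sample.\<close>
  define \<beta> where "\<beta> S = restrict_vec U (\<lambda>e. if w S e = 1 then 1 else -1)" for S
  have \<beta>: "\<beta> S \<in> full_sign_vectors U" for S
    by (auto simp: \<beta>_def full_sign_vectors_def restrict_vec_def)
  have "\<exists>S\<in>sign_vectors U. sv_le S T \<and> sv_le T (\<beta> S) \<and> card (supp S) \<le> VC_dim U (topes U L)"
    if T: "T \<in> realizable_samples U (topes U L)" for T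
  proof -
    obtain C where C: "C \<in> topes U L" "sv_le T C" and TU: "T \<in> sign_vectors U"
      using T by (auto simp: realizable_samples_def)
    define D where "D = supp T"
    define M where "M = restrict_vec D ` L"
    have D: "D \<subseteq> U" "finite D"
      using supp_sign_vectors[OF TU] fin by (auto simp: D_def intro: finite_subset)
    have M: "is_COM D M" using COM_deletion[OF L D(1)] by (simp add: M_def)
    have "restrict_vec D C = T"
    proof
      fix e
      show "restrict_vec D C e = T e"
        using C(2) by (cases "T e = 0") (auto simp: restrict_vec_def D_def supp_def sv_le_def)
    qed
    then have TM: "T \<in> M" using C(1) by (auto simp: M_def topes_def)
    obtain P where P: "minimal_on M {} P" "sv_le P T"
      using minimal_on_exists[of T M "{}"] TM D(2) by (auto simp: D_def)
    have "supp T - supp P \<subseteq> set xs" using D(1) xs(1) by (auto simp: D_def)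
    then obtain as where as: "flag M T P as" "filter (\<lambda>x. x \<in> set as) xs = as"
      using flag_exists[of T M P xs] P TM D(2) xs(2) by (auto simp: D_def minimal_on_def)
    have asD: "b \<in> D" "P b = 0" "T b \<noteq> 0" if "b \<in> set as" for b
      using flag_elements[OF as(1) that] by (auto simp: D_def supp_def)
    define S where "S = restrict_vec (set as) T"
    have suppS: "supp S = set as" using asD(3) by (auto simp: S_def supp_def restrict_vec_def)
    have "(\<lambda>x. S x \<noteq> 0) = (\<lambda>x. x \<in> set as)" using suppS by (auto simp: supp_def)
    then have as_of: "as_of S = as" using as(2) by (simp add: as_of_def)
    define W where "W = (SOME W. W \<in> L \<and> (\<forall>b\<in>set as. W b = 0))"
    have "\<exists>W. W \<in> L \<and> (\<forall>b\<in>set as. W b = 0)"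
    proof -
      obtain P' where P': "P' \<in> L" "P = restrict_vec D P'"
        using P(1) by (auto simp: minimal_on_def M_def)
      then show ?thesis using asD by (intro exI[of _ P']) (auto simp: restrict_vec_def)
    qed
    \<comment> \<open>The choice of \<open>W\<close> does not involve \<open>D\<close>, yet
      vanishing on \<open>as\<close> forces its restriction to be \<open>P\<close>, by spanning and
      uniqueness with \<open>B = {}\<close>.\<close>
    from someI_ex[OF this] have W: "W \<in> L" "\<forall>b\<in>set as. W b = 0" unfolding W_def by blast+
    have "restrict_vec D W \<in> M" "\<forall>b\<in>set as. restrict_vec D W b = 0"
      using W by (auto simp: M_def restrict_vec_def)
    moreover from this have "supp (restrict_vec D W) \<subseteq> supp P"
      using flag_spanning[OF M D(2) _ as(1)] by (auto simp: D_def)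
    ultimately have "restrict_vec D W = P"
      using minimal_on_unique[OF M D(2) P(1)] by blast
    then have "restrict_vec D (rebuild L S W as) = T"
      using rebuild_flag[OF L D, of T P as W S] as(1) W(1)
      by (auto simp: M_def D_def S_def restrict_vec_def)
    then have wT: "restrict_vec D (w S) = T" by (simp add: w_def as_of W_def)
    have "sv_le T (\<beta> S)"
      unfolding sv_le_def
    proof
      fix e
      show "T e = 0 \<or> T e = \<beta> S e"
      proof (cases "e \<in> D")
        case True
        then have "w S e = T e" using fun_cong[OF wT, of e] by (simp add: restrict_vec_def)
        then show ?thesis using True D(1) sign_vectors_values[OF TU, of e]
          by (auto simp: \<beta>_def restrict_vec_def)
      qed (simp add: D_def supp_def)
    qed
    moreover have "sv_le S T" by (auto simp: S_def sv_le_def restrict_vec_def)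
    moreover have "S \<in> sign_vectors U"
      using TU by (auto simp: S_def sign_vectors_def restrict_vec_def)
    moreover have "card (supp S) \<le> VC_dim U (topes U L)"
    proof -
      have "shattered (topes U L) (set as)"
        using flag_shattered[OF L D(1) _ _ C(1)] as(1) by (simp add: M_def D_def)
      then show ?thesis
        using card_shattered_le_VC_dim[OF fin] asD(1) D(1) suppS by (metis subset_iff)
    qed
    ultimately show ?thesis by blast
  qed
  then obtain \<alpha> where \<alpha>: "\<forall>T\<in>realizable_samples U (topes U L).
      \<alpha> T \<in> sign_vectors U \<and> sv_le (\<alpha> T) T \<and> sv_le T (\<beta> (\<alpha> T)) \<and>
      card (supp (\<alpha> T)) \<le> VC_dim U (topes U L)"
    by metis
  \<comment> \<open>The identity off the realizable samples keeps the values sign vectors on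
    \<open>U\<close>.\<close>
  define \<alpha>' where "\<alpha>' T = (if T \<in> realizable_samples U (topes U L) then \<alpha> T else T)" for T
  have "labeled_compression_scheme U (topes U L) (VC_dim U (topes U L)) \<alpha>' \<beta>"
    using \<alpha> \<beta> by (auto simp: labeled_compression_scheme_def \<alpha>'_def)
  then show ?thesis by blast
qed

theorem corollary3:
  fixes U :: "'a set" and L :: "'a signvec set" and d :: nat
  assumes "finite U"
    and "simple_system U L"
    and "is_OM U L \<or> is_CUOM U L"
    and "VC_dim U (topes U L) = d"
  shows "\<exists>\<alpha> \<beta>. labeled_compression_scheme U (topes U L) d \<alpha> \<beta>"
proof -
  have "is_COM U L" using assms(3) by (auto simp: is_OM_def is_CUOM_def)
  from COM_compression[OF assms(1) this] show ?thesis using assms(4) by simp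
qed

end
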